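(* Let $d \ge 1$ and $r \ge 2$ be integers, let $\|\cdot\|$ be any norm on $\mathbb{R}^d$, and let $B = \{v \in \mathbb{R}^d : \|v\| \le 1\}$ be its unit ball. Let $V = (v_1, v_2, \dots)$ be a finite or infinite sequence of vectors in $B$. Then there is a partition of $V$ into $r$ subsequences $X_1, \dots, X_r$ (i.e., every term $v_i$ belongs to exactly one $X_j$) such that for all $k$ and all $j \in \{1,\dots,r\}$, \[ \sum_k X_j \in \frac{1}{r}\sum_k V + C(r)\, d\, B, \] that is, $\big\|\sum_k X_j - \tfrac1r \sum_k V\big\| \le C(r)\,d$, where $C(r)$ is a constant depending only on $r$ and satisfying $C(r) \le 2.0005$. In particular the bound $2.0005\,d$ holds for every $r$.
   Context: For a sequence $V = (v_1, v_2, \dots)$ and an integer $k \ge 1$ (at most the length of $V$), $\sum_k V = \sum_{i=1}^k v_i$. For a subsequence $X$ of $V$, $\sum_k X = \sum_{i \le k,\ v_i \in X} v_i$ (sum over those indices $i \le k$ whose term belongs to $X$). For a set $S\subseteq\mathbb{R}^d$ and $c\ge 0$, $S + cB=\{s+cb: s\in S, b\in B\}$. *)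

theory Defs
  imports Main "HOL.Real"
begin

text \<open>Vectors of R^d are represented as functions nat => real vanishing outside {..<d},
  so that the dimension d can be quantified inside the formula (needed because C(r)
  must not depend on d).\<close>

definition Rvec :: "nat \<Rightarrow> (nat \<Rightarrow> real) set" where
  "Rvec d = {v. \<forall>i\<ge>d. v i = 0}"

definition norm_on :: "nat \<Rightarrow> ((nat \<Rightarrow> real) \<Rightarrow> real) \<Rightarrow> bool" where
  "norm_on d N \<longleftrightarrow>
     (\<forall>x\<in>Rvec d. N x = 0 \<longleftrightarrow> x = (\<lambda>_. 0)) \<and>
     (\<forall>x\<in>Rvec d. \<forall>c. N (\<lambda>i. c * x i) = \<bar>c\<bar> * N x) \<and>
     (\<forall>x\<in>Rvec d. \<forall>y\<in>Rvec d. N (\<lambda>i. x i + y i) \<le> N x + N y)"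

definition seq_index :: "nat set \<Rightarrow> bool" where
  "seq_index I \<longleftrightarrow> I = {1..} \<or> (\<exists>n. I = {1..n})"

end

theory Submission
  imports Defs
begin

text \<open>
  For a share \<open>\<theta>\<close>, a single set \<open>X\<close> of indices approximates \<open>\<theta>\<close> times every prefix sum up to an error \<open>d\<close>:
  starting from weights \<open>\<theta>\<close>, move the weights of the first \<open>k\<close> vectors along linear dependences, preserving
  their weighted sum, until at most \<open>d\<close> of them are not yet \<open>0\<close> or \<open>1\<close>; settled weights never change
  again, so the final choice differs from the weights at time \<open>k\<close> in at most \<open>d\<close> places.

  Splitting first with \<open>\<theta> = a / (a + b)\<close> and then the two parts into \<open>a\<close> and \<open>b\<close> classes shows that
  constants \<open>C a\<close>, \<open>C b\<close> give the constant \<open>max (C a + 1 / a) (C b + 1 / b)\<close> for \<open>a + b\<close>, from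
  \<open>C 1 = 0\<close>. Halving alone loses too much for small odd numbers, so the splittings of numbers up to
  \<open>11500\<close> come from an explicit list; beyond that halving is harmless.
\<close>

section \<open>Splitting a sequence in a given proportion\<close>

text \<open>Gaussian elimination on the last coordinate: if some \<open>v p\<close> is nonzero
  there, subtracting multiples of it clears that coordinate in the other vectors, which leaves one
  vector and one dimension fewer.\<close>

lemma Rvec_linear_dependence:
  fixes v :: "'a \<Rightarrow> nat \<Rightarrow> real"
  assumes "finite F" "d < card F" "\<forall>i\<in>F. v i \<in> Rvec d"
  shows "\<exists>\<beta>. (\<exists>i\<in>F. \<beta> i \<noteq> 0) \<and> (\<forall>c. (\<Sum>i\<in>F. \<beta> i * v i c) = 0)"
  using assms
proof (induction d arbitrary: F v)
  case 0
  then have "F \<noteq> {}" by auto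
  with 0 show ?case
    by (intro exI[of _ "\<lambda>_. 1"]) (auto simp: Rvec_def)
next
  case (Suc d)
  show ?case
  proof (cases "\<forall>i\<in>F. v i d = 0")
    case True
    then have "\<forall>i\<in>F. v i \<in> Rvec d"
      using Suc.prems(3) by (auto simp: Rvec_def) (metis le_antisym not_less_eq_eq)
    with Suc show ?thesis by simp
  next
    case False
    then obtain p where p: "p \<in> F" "v p d \<noteq> 0" by blast
    define v' where "v' i c = v i c - v i d / v p d * v p c" for i c
    have "\<forall>i\<in>F - {p}. v' i \<in> Rvec d"
    proof (intro ballI)
      fix i assume "i \<in> F - {p}"
      then have "\<forall>c\<ge>Suc d. v i c = 0" "\<forall>c\<ge>Suc d. v p c = 0"
        using Suc.prems(3) p by (auto simp: Rvec_def)
      then have "v' i c = 0" if "c \<ge> d" for c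
        using that p by (cases "c = d") (auto simp: v'_def)
      then show "v' i \<in> Rvec d" by (simp add: Rvec_def)
    qed
    moreover have "d < card (F - {p})" using Suc.prems p by simp
    ultimately obtain \<beta> where \<beta>: "\<exists>i\<in>F-{p}. \<beta> i \<noteq> 0"
      "\<And>c. (\<Sum>i\<in>F-{p}. \<beta> i * v' i c) = 0"
      using Suc.IH[of "F - {p}" v'] Suc.prems(1) by blast
    \<comment> \<open>The coefficient of the pivot cancels the multiples of \<open>v p\<close> that
      were subtracted in \<open>v'\<close>.\<close>
    define \<gamma> where "\<gamma> = \<beta>(p := - (\<Sum>i\<in>F-{p}. \<beta> i * v i d / v p d))"
    have "(\<Sum>i\<in>F. \<gamma> i * v i c) = 0" for c
    proof -
      have "(\<Sum>i\<in>F. \<gamma> i * v i c) = \<gamma> p * v p c + (\<Sum>i\<in>F-{p}. \<gamma> i * v i c)"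
        using p Suc.prems(1) by (simp add: sum.remove)
      also have "(\<Sum>i\<in>F-{p}. \<gamma> i * v i c) = (\<Sum>i\<in>F-{p}. \<beta> i * v i c)"
        by (intro sum.cong) (auto simp: \<gamma>_def)
      also have "\<gamma> p * v p c + \<dots> = (\<Sum>i\<in>F-{p}. \<beta> i * v' i c)"
        by (simp add: \<gamma>_def v'_def algebra_simps sum_subtractf sum_distrib_left sum_distrib_right)
      finally show ?thesis using \<beta>(2) by simp
    qed
    moreover have "\<exists>i\<in>F. \<gamma> i \<noteq> 0" using \<beta>(1) by (auto simp: \<gamma>_def)
    ultimately show ?thesis by blast
  qed
qed

text \<open>The vectors of more than \<open>d\<close> fractional weights are linearly dependent.
  Moving along the dependence keeps the weighted sum, and stopping as soon as one weight hits 0 or 1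
  lowers the number of fractional weights.\<close>

lemma reduce_fractional:
  fixes v :: "'a \<Rightarrow> nat \<Rightarrow> real"
  assumes "finite F" "\<forall>i\<in>F. v i \<in> Rvec d" "\<forall>i. 0 \<le> \<alpha> i \<and> \<alpha> i \<le> 1"
  shows "\<exists>\<alpha>'. (\<forall>i. 0 \<le> \<alpha>' i \<and> \<alpha>' i \<le> 1) \<and> (\<forall>i. i \<notin> F \<or> \<alpha> i \<in> {0,1} \<longrightarrow> \<alpha>' i = \<alpha> i) \<and>
    (\<forall>c. (\<Sum>i\<in>F. \<alpha>' i * v i c) = (\<Sum>i\<in>F. \<alpha> i * v i c)) \<and>
    card {i\<in>F. \<alpha>' i \<notin> {0,1::real}} \<le> d"
  using assms(3)
proof (induction "card {i\<in>F. \<alpha> i \<notin> {0,1}}" arbitrary: \<alpha> rule: less_induct)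
  case less
  define G where "G = {i\<in>F. \<alpha> i \<notin> {0,1}}"
  have fin: "finite G" using assms(1) by (simp add: G_def)
  show ?case
  proof (cases "card G \<le> d")
    case True
    then show ?thesis using less.prems unfolding G_def by (intro exI[of _ \<alpha>]) auto
  next
    case False
    then obtain \<beta> where \<beta>: "\<exists>i\<in>G. \<beta> i \<noteq> 0" "\<And>c. (\<Sum>i\<in>G. \<beta> i * v i c) = 0"
      using Rvec_linear_dependence[of G d v] fin assms(2) by (auto simp: G_def)
    \<comment> \<open>\<open>\<tau> i\<close> is the time at which weight \<open>i\<close>, moving
      at speed \<open>\<beta> i\<close>, reaches the end of [0,1]. The minimum is taken over
      \<open>H\<close> only: weights at rest never reach it, while division by zero would give them
      time 0.\<close>
    define H where "H = {i\<in>G. \<beta> i \<noteq> 0}"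
    define \<tau> where "\<tau> i = (if \<beta> i > 0 then 1 - \<alpha> i else \<alpha> i) / \<bar>\<beta> i\<bar>" for i
    have H: "finite H" "H \<noteq> {}" using fin \<beta>(1) by (auto simp: H_def)
    define p where "p = arg_min_on \<tau> H"
    have p: "p \<in> H" and pmin: "\<And>i. i \<in> H \<Longrightarrow> \<tau> p \<le> \<tau> i"
      using arg_min_if_finite[OF H, of \<tau>] arg_min_least[OF H, of _ \<tau>] by (auto simp: p_def)
    have \<tau>0: "0 \<le> \<tau> p" using less.prems by (simp add: \<tau>_def)
    define \<alpha>1 where "\<alpha>1 i = (if i \<in> G then \<alpha> i + \<tau> p * \<beta> i else \<alpha> i)" for i
    have bnd: "0 \<le> \<alpha>1 i \<and> \<alpha>1 i \<le> 1" for i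
    proof (cases "i \<in> H")
      case True
      then have "\<beta> i \<noteq> 0" by (simp add: H_def)
      then have "\<tau> p * \<bar>\<beta> i\<bar> \<le> (if \<beta> i > 0 then 1 - \<alpha> i else \<alpha> i)"
        using pmin[OF True] by (subst (asm) (2) \<tau>_def) (simp add: pos_le_divide_eq)
      moreover have "0 \<le> \<tau> p * \<bar>\<beta> i\<bar>" using \<tau>0 by simp
      ultimately show ?thesis
        using less.prems[rule_format, of i] True
        by (cases "\<beta> i > 0") (auto simp: \<alpha>1_def H_def)
    next
      case False
      then show ?thesis using less.prems by (auto simp: \<alpha>1_def H_def)
    qed
    have \<alpha>1p: "\<alpha>1 p \<in> {0,1}"
    proof -
      have "p \<in> G" "\<beta> p \<noteq> 0" using p by (auto simp: H_def)
      then have "\<tau> p * \<beta> p = (if \<beta> p > 0 then 1 - \<alpha> p else - \<alpha> p)"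
        unfolding \<tau>_def by (simp add: abs_if)
      then show ?thesis using \<open>p \<in> G\<close> by (simp add: \<alpha>1_def)
    qed
    have \<alpha>1_out: "\<alpha>1 i = \<alpha> i" if "i \<notin> G" for i using that by (simp add: \<alpha>1_def)
    \<comment> \<open>Only weights in \<open>G\<close> move, so settled weights stay settled, and
      \<open>p\<close> has just joined them.\<close>
    have "{i\<in>F. \<alpha>1 i \<notin> {0,1}} \<subseteq> G - {p}"
    proof
      fix i assume i: "i \<in> {i\<in>F. \<alpha>1 i \<notin> {0,1}}"
      then have "i \<in> G" using \<alpha>1_out[of i] by (cases "i \<in> G") (simp_all add: G_def)
      then show "i \<in> G - {p}" using i \<alpha>1p by blast
    qed
    then have "card {i\<in>F. \<alpha>1 i \<notin> {0,1}} \<le> card (G - {p})"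
      using fin by (intro card_mono) auto
    also have "\<dots> < card G" using p fin by (intro card_Diff1_less) (auto simp: H_def)
    finally obtain \<alpha>' where \<alpha>': "\<forall>i. 0 \<le> \<alpha>' i \<and> \<alpha>' i \<le> 1"
      "\<forall>i. i \<notin> F \<or> \<alpha>1 i \<in> {0,1} \<longrightarrow> \<alpha>' i = \<alpha>1 i"
      "\<forall>c. (\<Sum>i\<in>F. \<alpha>' i * v i c) = (\<Sum>i\<in>F. \<alpha>1 i * v i c)"
      "card {i\<in>F. \<alpha>' i \<notin> {0,1}} \<le> d"
      using less.hyps[of \<alpha>1] bnd unfolding G_def by auto
    have "(\<Sum>i\<in>F. \<alpha>1 i * v i c) = (\<Sum>i\<in>F. \<alpha> i * v i c)" for c
    proof -
      have "(\<Sum>i\<in>F. \<alpha>1 i * v i c) = (\<Sum>i\<in>F. \<alpha> i * v i c + (if i \<in> G then \<tau> p * (\<beta> i * v i c) else 0))"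
        by (intro sum.cong) (auto simp: \<alpha>1_def algebra_simps)
      also have "\<dots> = (\<Sum>i\<in>F. \<alpha> i * v i c) + (\<Sum>i\<in>F \<inter> G. \<tau> p * (\<beta> i * v i c))"
        using assms(1) by (simp add: sum.distrib sum.inter_restrict)
      also have "F \<inter> G = G" by (auto simp: G_def)
      finally show ?thesis using \<beta>(2) by (simp flip: sum_distrib_left)
    qed
    moreover have "\<alpha>' i = \<alpha> i" if "i \<notin> F \<or> \<alpha> i \<in> {0,1}" for i
    proof -
      have "i \<notin> G" using that by (auto simp: G_def)
      then show ?thesis using \<alpha>'(2) that \<alpha>1_out by metis
    qed
    ultimately show ?thesis using \<alpha>' by (intro exI[of _ \<alpha>']) auto
  qed
qed

section \<open>Norms of finite linear combinations\<close>

lemma Rvec_scale: "x \<in> Rvec d \<Longrightarrow> (\<lambda>c. a * x c) \<in> Rvec d"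
  by (auto simp: Rvec_def)

lemma Rvec_sum: "\<forall>i\<in>F. v i \<in> Rvec d \<Longrightarrow> (\<lambda>c. \<Sum>i\<in>F. a i * v i c) \<in> Rvec d"
  by (auto simp: Rvec_def intro!: sum.neutral)

lemma norm_on_scale: "norm_on d N \<Longrightarrow> x \<in> Rvec d \<Longrightarrow> N (\<lambda>c. a * x c) = \<bar>a\<bar> * N x"
  and norm_on_triangle: "norm_on d N \<Longrightarrow> x \<in> Rvec d \<Longrightarrow> y \<in> Rvec d \<Longrightarrow> N (\<lambda>c. x c + y c) \<le> N x + N y"
  by (auto simp: norm_on_def)

lemma norm_on_sum_le:
  assumes "norm_on d N" "finite F" "\<forall>i\<in>F. v i \<in> Rvec d \<and> N (v i) \<le> 1"
  shows "N (\<lambda>c. \<Sum>i\<in>F. a i * v i c) \<le> (\<Sum>i\<in>F. \<bar>a i\<bar>)"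
  using assms(2,3)
proof (induction F)
  case empty
  have "(\<lambda>_. 0) \<in> Rvec d" by (simp add: Rvec_def)
  then show ?case using assms(1) by (auto simp: norm_on_def)
next
  case (insert j F)
  have "N (\<lambda>c. a j * v j c + (\<Sum>i\<in>F. a i * v i c))
      \<le> N (\<lambda>c. a j * v j c) + N (\<lambda>c. \<Sum>i\<in>F. a i * v i c)"
    using insert.prems by (intro norm_on_triangle[OF assms(1)] Rvec_sum Rvec_scale) auto
  also have "N (\<lambda>c. a j * v j c) = \<bar>a j\<bar> * N (v j)"
    using insert.prems by (intro norm_on_scale[OF assms(1)]) auto
  also have "\<dots> \<le> \<bar>a j\<bar>" using insert.prems by (intro mult_left_le) auto
  finally show ?case using insert by simp
qed

lemma weighted_split:
  fixes v :: "nat \<Rightarrow> nat \<Rightarrow> real"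
  assumes "norm_on d N" "\<forall>i. v i \<in> Rvec d \<and> N (v i) \<le> 1" "0 \<le> \<theta>" "\<theta> \<le> 1"
  shows "\<exists>X. \<forall>k. N (\<lambda>c. \<Sum>i\<in>{1..k}. (of_bool (i \<in> X) - \<theta>) * v i c) \<le> real d"
proof -
  \<comment> \<open>Weights beyond \<open>k\<close> still equal \<open>\<theta>\<close>, so the next
    vector enters with its prescribed share and the equality of weighted sums extends to
    \<open>Suc k\<close>.\<close>
  define P where "P k \<alpha> \<longleftrightarrow> (\<forall>i. 0 \<le> \<alpha> i \<and> \<alpha> i \<le> 1) \<and> (\<forall>i>k. \<alpha> i = \<theta>) \<and>
    (\<forall>c. (\<Sum>i\<in>{1..k}. \<alpha> i * v i c) = (\<Sum>i\<in>{1..k}. \<theta> * v i c)) \<and>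
    card {i\<in>{1..k}. \<alpha> i \<notin> {0,1::real}} \<le> d" for k \<alpha>
  define Q where "Q (k::nat) \<alpha> \<alpha>' \<longleftrightarrow> (\<forall>i. \<alpha> i \<in> {0,1::real} \<longrightarrow> \<alpha>' i = \<alpha> i)"
    for k :: nat and \<alpha> \<alpha>' :: "nat \<Rightarrow> real"
  have "\<exists>A. \<forall>k. P k (A k) \<and> Q k (A k) (A (Suc k))"
  proof (intro dependent_nat_choice)
    show "\<exists>\<alpha>. P 0 \<alpha>" using assms(3,4) by (intro exI[of _ "\<lambda>_. \<theta>"]) (simp add: P_def)
  next
    fix \<alpha> k assume \<alpha>: "P k \<alpha>"
    obtain \<alpha>' where \<alpha>': "\<forall>i. 0 \<le> \<alpha>' i \<and> \<alpha>' i \<le> 1"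
      "\<forall>i. i \<notin> {1..Suc k} \<or> \<alpha> i \<in> {0,1} \<longrightarrow> \<alpha>' i = \<alpha> i"
      "\<forall>c. (\<Sum>i\<in>{1..Suc k}. \<alpha>' i * v i c) = (\<Sum>i\<in>{1..Suc k}. \<alpha> i * v i c)"
      "card {i\<in>{1..Suc k}. \<alpha>' i \<notin> {0,1}} \<le> d"
      using reduce_fractional[of "{1..Suc k}" v d \<alpha>] assms(2) \<alpha> unfolding P_def by blast
    have "P (Suc k) \<alpha>'" using \<alpha> \<alpha>' by (simp add: P_def)
    moreover have "Q k \<alpha> \<alpha>'" using \<alpha>'(2) by (simp add: Q_def)
    ultimately show "\<exists>\<alpha>'. P (Suc k) \<alpha>' \<and> Q k \<alpha> \<alpha>'" by blast
  qed
  then obtain A where A: "\<And>k. P k (A k)" "\<And>k. Q k (A k) (A (Suc k))" by blast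
  have frozen: "A m i = A k i" if "A k i \<in> {0,1}" "k \<le> m" for k m i
    using that(2)
  proof (induction rule: dec_induct)
    case (step n)
    then show ?case using A(2)[of n] that(1) unfolding Q_def by metis
  qed simp
  \<comment> \<open>An index whose weight stays fractional forever falls outside \<open>X\<close>.
    At each time \<open>k\<close> from its arrival on it is among the at most \<open>d\<close>
    fractional ones, so this default adds nothing to the error count.\<close>
  define X where "X = {i. \<exists>k. A k i = 1 \<and> i \<le> k}"
  have X: "of_bool (i \<in> X) = A k i" if "A k i \<in> {0,1}" "i \<le> k" for i k
  proof (cases "A k i = 1")
    case True
    then show ?thesis using that by (auto simp: X_def)
  next
    case False
    then have 0: "A k i = 0" using that by simp
    have "A m i \<noteq> 1" for m
      using frozen[of k i m] frozen[of m i k] 0 by (cases "k \<le> m") auto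
    then show ?thesis using 0 by (simp add: X_def)
  qed
  have "N (\<lambda>c. \<Sum>i\<in>{1..k}. (of_bool (i \<in> X) - \<theta>) * v i c) \<le> real d" for k
  proof -
    define G where "G = {i\<in>{1..k}. A k i \<notin> {0,1}}"
    have Ak: "\<forall>i. 0 \<le> A k i \<and> A k i \<le> 1" "card G \<le> d"
      "\<And>c. (\<Sum>i\<in>{1..k}. A k i * v i c) = (\<Sum>i\<in>{1..k}. \<theta> * v i c)"
      using A(1)[of k] by (auto simp: P_def G_def)
    \<comment> \<open>By the invariant, \<open>\<theta>\<close> can be replaced by the weights at
      time \<open>k\<close>; outside \<open>G\<close> these already agree with the final choice, so
      at most \<open>d\<close> terms survive.\<close>
    have "(\<Sum>i\<in>{1..k}. (of_bool (i \<in> X) - \<theta>) * v i c) = (\<Sum>i\<in>G. (of_bool (i \<in> X) - A k i) * v i c)" for c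
    proof -
      have "(\<Sum>i\<in>{1..k}. (of_bool (i \<in> X) - \<theta>) * v i c)
          = (\<Sum>i\<in>{1..k}. (of_bool (i \<in> X) - A k i) * v i c)"
        using Ak(3)[of c] by (simp add: left_diff_distrib sum_subtractf)
      also have "\<dots> = (\<Sum>i\<in>G. (of_bool (i \<in> X) - A k i) * v i c)"
        by (rule sum.mono_neutral_right) (auto simp: G_def X)
      finally show ?thesis .
    qed
    then have "N (\<lambda>c. \<Sum>i\<in>{1..k}. (of_bool (i \<in> X) - \<theta>) * v i c)
        \<le> (\<Sum>i\<in>G. \<bar>of_bool (i \<in> X) - A k i\<bar>)"
      using norm_on_sum_le[OF assms(1), of G v "\<lambda>i. of_bool (i \<in> X) - A k i"] assms(2)
      by (simp add: G_def)
    also have "\<dots> \<le> (\<Sum>i\<in>G. 1)"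
    proof (intro sum_mono)
      show "\<bar>of_bool (i \<in> X) - A k i\<bar> \<le> 1" for i
        using Ak(1)[rule_format, of i] by (cases "i \<in> X") auto
    qed
    also have "\<dots> \<le> real d" using Ak(2) by simp
    finally show ?thesis .
  qed
  then show ?thesis by blast
qed

section \<open>Partitions into several classes\<close>

text \<open>Sequences are total here: finite sequences and subsequences carry zero vectors in the
  missing places, so \<open>k\<close> denotes the same prefix throughout. \<open>C\<close> is
  uniform in the dimension and the norm.\<close>

definition balanced :: "nat \<Rightarrow> real \<Rightarrow> bool" where
  "balanced r C \<longleftrightarrow> (\<forall>d N (v :: nat \<Rightarrow> nat \<Rightarrow> real).
     norm_on d N \<longrightarrow> (\<forall>i. v i \<in> Rvec d \<and> N (v i) \<le> 1) \<longrightarrow>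
     (\<exists>f. (\<forall>i. f i \<in> {1..r}) \<and>
       (\<forall>k. \<forall>j\<in>{1..r}. N (\<lambda>c. \<Sum>i\<in>{1..k}. (of_bool (f i = j) - 1 / real r) * v i c) \<le> C * real d)))"

lemma balancedD:
  fixes v :: "nat \<Rightarrow> nat \<Rightarrow> real"
  assumes "balanced r C" "norm_on d N" "\<forall>i. v i \<in> Rvec d \<and> N (v i) \<le> 1"
  shows "\<exists>f. (\<forall>i. f i \<in> {1..r}) \<and> (\<forall>k. \<forall>j\<in>{1..r}.
    N (\<lambda>c. \<Sum>i\<in>{1..k}. (of_bool (f i = j) - 1 / real r) * v i c) \<le> C * real d)"
  using assms unfolding balanced_def by blast

lemma balanced_mono:
  assumes "balanced r C" "C \<le> C'"
  shows "balanced r C'"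
  unfolding balanced_def
proof (intro allI impI)
  fix d N and v :: "nat \<Rightarrow> nat \<Rightarrow> real"
  assume "norm_on d N" "\<forall>i. v i \<in> Rvec d \<and> N (v i) \<le> 1"
  then obtain f where f: "\<And>i. f i \<in> {1..r}" "\<And>k j. j \<in> {1..r} \<Longrightarrow>
      N (\<lambda>c. \<Sum>i\<in>{1..k}. (of_bool (f i = j) - 1 / real r) * v i c) \<le> C * real d"
    using balancedD[OF assms(1)] by meson
  have "C * real d \<le> C' * real d" using assms(2) by (intro mult_right_mono) auto
  then show "\<exists>f. (\<forall>i. f i \<in> {1..r}) \<and> (\<forall>k. \<forall>j\<in>{1..r}.
      N (\<lambda>c. \<Sum>i\<in>{1..k}. (of_bool (f i = j) - 1 / real r) * v i c) \<le> C' * real d)"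
    using f by (intro exI[of _ f]) (blast intro: order_trans)
qed

lemma norm_on_zero: "norm_on d N \<Longrightarrow> N (\<lambda>_. 0) = 0"
  by (auto simp: norm_on_def Rvec_def)

lemma balanced_1: "balanced 1 0"
  unfolding balanced_def
  by (intro allI impI exI[of _ "\<lambda>_. 1"]) (auto simp: norm_on_zero)

text \<open>The ideal share of a class is \<open>1 / a\<close> of the ideal share of
  \<open>X\<close>, so each class inherits only the fraction \<open>1 / a\<close> of the error made
  in choosing \<open>X\<close>, on top of the error of splitting \<open>X\<close> itself.\<close>

lemma norm_on_split_error:
  assumes N: "norm_on d N" and v: "\<forall>i. v i \<in> Rvec d" and "0 < (a::nat)"
    and inner: "N (\<lambda>c. \<Sum>i\<in>{1..k}. (of_bool (f i = j) - 1 / real a) * (of_bool (i \<in> X) * v i c)) \<le> C * real d"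
    and outer: "N (\<lambda>c. \<Sum>i\<in>{1..k}. (of_bool (i \<in> X) - real a / real r) * v i c) \<le> real d"
  shows "N (\<lambda>c. \<Sum>i\<in>{1..k}. (of_bool (i \<in> X \<and> f i = j) - 1 / real r) * v i c) \<le> (C + 1 / a) * real d"
proof -
  let ?u = "\<lambda>c. \<Sum>i\<in>{1..k}. (of_bool (f i = j) - 1 / real a) * (of_bool (i \<in> X) * v i c)"
  let ?w = "\<lambda>c. \<Sum>i\<in>{1..k}. (of_bool (i \<in> X) - real a / real r) * v i c"
  have R: "?u \<in> Rvec d" "?w \<in> Rvec d"
    using v by (auto intro!: Rvec_sum Rvec_scale)
  have "(\<Sum>i\<in>{1..k}. (of_bool (i \<in> X \<and> f i = j) - 1 / real r) * v i c) = ?u c + (1 / real a) * ?w c" for c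
    unfolding sum_distrib_left sum.distrib[symmetric]
  proof (intro sum.cong refl)
    show "(of_bool (i \<in> X \<and> f i = j) - 1 / real r) * v i c
        = (of_bool (f i = j) - 1 / real a) * (of_bool (i \<in> X) * v i c)
          + 1 / real a * ((of_bool (i \<in> X) - real a / real r) * v i c)" for i
      using \<open>0 < a\<close> by (cases "i \<in> X") (auto simp: algebra_simps)
  qed
  then have "N (\<lambda>c. \<Sum>i\<in>{1..k}. (of_bool (i \<in> X \<and> f i = j) - 1 / real r) * v i c) \<le> N ?u + N (\<lambda>c. (1 / real a) * ?w c)"
    using norm_on_triangle[OF N R(1) Rvec_scale[OF R(2)], of "1 / real a"] by simp
  also have "N (\<lambda>c. (1 / real a) * ?w c) = \<bar>1 / real a\<bar> * N ?w"
    by (rule norm_on_scale[OF N R(2)])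
  also have "\<dots> \<le> (1 / real a) * real d"
    using outer by (simp add: divide_right_mono)
  finally show ?thesis using inner by (simp add: algebra_simps)
qed

lemma balanced_add:
  assumes a: "balanced a C" and b: "balanced b D" and pos: "0 < a" "0 < b"
    and E: "C + 1 / a \<le> E" "D + 1 / b \<le> E"
  shows "balanced (a + b) E"
  unfolding balanced_def
proof (intro allI impI)
  fix d N and v :: "nat \<Rightarrow> nat \<Rightarrow> real"
  assume N: "norm_on d N" and v: "\<forall>i. v i \<in> Rvec d \<and> N (v i) \<le> 1"
  let ?r = "a + b"
  obtain X where X: "\<And>k. N (\<lambda>c. \<Sum>i\<in>{1..k}. (of_bool (i \<in> X) - real a / real ?r) * v i c) \<le> real d"
    using weighted_split[OF N v, of "real a / real ?r"] pos by auto
  \<comment> \<open>The error of the complement is the negative of that of \<open>X\<close>, so one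
    choice serves both shares.\<close>
  have Y: "N (\<lambda>c. \<Sum>i\<in>{1..k}. (of_bool (i \<in> -X) - real b / real ?r) * v i c) \<le> real d" for k
  proof -
    let ?w = "\<lambda>c. \<Sum>i\<in>{1..k}. (of_bool (i \<in> X) - real a / real ?r) * v i c"
    have "?w \<in> Rvec d" using v by (auto intro!: Rvec_sum)
    then have "N (\<lambda>c. (-1) * ?w c) = \<bar>-1\<bar> * N ?w" by (rule norm_on_scale[OF N])
    moreover have "(\<Sum>i\<in>{1..k}. (of_bool (i \<in> -X) - real b / real ?r) * v i c) = (-1) * ?w c" for c
      unfolding sum_distrib_left
    proof (intro sum.cong refl)
      have b: "real b / real ?r = 1 - real a / real ?r" using pos by (simp add: field_simps)
      show "(of_bool (i \<in> -X) - real b / real ?r) * v i c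
          = - 1 * ((of_bool (i \<in> X) - real a / real ?r) * v i c)" for i
        unfolding b by (cases "i \<in> X") (simp_all add: left_diff_distrib)
    qed
    ultimately show ?thesis using X[of k] by simp
  qed
  \<comment> \<open>Both parts are formed by zeroing vectors instead of renumbering them; this keeps
    the prefixes aligned.\<close>
  have vX: "\<forall>i. (\<lambda>c. of_bool (i \<in> Z) * v i c) \<in> Rvec d \<and> N (\<lambda>c. of_bool (i \<in> Z) * v i c) \<le> 1" for Z
    using v norm_on_zero[OF N] by (auto simp: Rvec_def)
  obtain f where f: "\<And>i. f i \<in> {1..a}" "\<And>k j. j \<in> {1..a} \<Longrightarrow>
      N (\<lambda>c. \<Sum>i\<in>{1..k}. (of_bool (f i = j) - 1 / real a) * (of_bool (i \<in> X) * v i c)) \<le> C * real d"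
    using balancedD[OF a N vX[of X]] by blast
  obtain g where g: "\<And>i. g i \<in> {1..b}" "\<And>k j. j \<in> {1..b} \<Longrightarrow>
      N (\<lambda>c. \<Sum>i\<in>{1..k}. (of_bool (g i = j) - 1 / real b) * (of_bool (i \<in> -X) * v i c)) \<le> D * real d"
    using balancedD[OF b N vX[of "-X"]] by blast
  define h where "h i = (if i \<in> X then f i else a + g i)" for i
  have "N (\<lambda>c. \<Sum>i\<in>{1..k}. (of_bool (h i = j) - 1 / real ?r) * v i c) \<le> E * real d"
    if j: "j \<in> {1..?r}" for k j
  proof (cases "j \<le> a")
    case True
    have "(h i = j) = (i \<in> X \<and> f i = j)" for i
      using True g(1)[of i] by (auto simp: h_def)
    then have "N (\<lambda>c. \<Sum>i\<in>{1..k}. (of_bool (h i = j) - 1 / real ?r) * v i c) \<le> (C + 1 / a) * real d"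
      using norm_on_split_error[OF N _ pos(1) f(2) X, of j k] v j True by simp
    also have "\<dots> \<le> E * real d" using E by (intro mult_right_mono) auto
    finally show ?thesis .
  next
    case False
    then have j': "j - a \<in> {1..b}" using j by auto
    have "(h i = j) = (i \<in> -X \<and> g i = j - a)" for i
      using False f(1)[of i] by (auto simp: h_def)
    then have "N (\<lambda>c. \<Sum>i\<in>{1..k}. (of_bool (h i = j) - 1 / real ?r) * v i c) \<le> (D + 1 / b) * real d"
      using norm_on_split_error[OF N _ pos(2) g(2)[rule_format, OF j'] Y, of k] v by simp
    also have "\<dots> \<le> E * real d" using E by (intro mult_right_mono) auto
    finally show ?thesis .
  qed
  moreover have "h i \<in> {1..?r}" for i
    using f(1)[of i] g(1)[of i] by (auto simp: h_def)
  ultimately show "\<exists>f. (\<forall>i. f i \<in> {1..?r}) \<and> (\<forall>k. \<forall>j\<in>{1..?r}.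
      N (\<lambda>c. \<Sum>i\<in>{1..k}. (of_bool (f i = j) - 1 / real ?r) * v i c) \<le> E * real d)"
    by blast
qed

section \<open>The bound 2.0005\<close>

text \<open>
  Upper bounds for \<open>C\<close> are computed in units of \<open>10\<^sup>-\<^sup>8\<close>, rounding up. A row \<open>(L, c)\<close> asserts the bound
  \<open>c\<close> for all \<open>r\<close> from \<open>L\<close> up to the start of the row before it in the list (rows are listed by
  descending \<open>L\<close>); rows are grouped into blocks \<open>(B, rows)\<close> with \<open>L \<ge> B\<close> only to make lookups cheap.
  The bound looked up for an interval of which a table covers just a part is valid on that part.
\<close>

fun rows_max :: "(nat \<times> nat) list \<Rightarrow> nat \<Rightarrow> nat \<Rightarrow> nat" where
  "rows_max [] lo hi = 0"
| "rows_max ((L, c) # rows) lo hi =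
     (if hi < L then rows_max rows lo hi
      else if L \<le> lo then c else max c (rows_max rows lo hi))"

fun table_max :: "(nat \<times> (nat \<times> nat) list) list \<Rightarrow> nat \<Rightarrow> nat \<Rightarrow> nat" where
  "table_max [] lo hi = 0"
| "table_max ((B, rows) # T) lo hi =
     (if hi < B then table_max T lo hi
      else if B \<le> lo then rows_max rows lo hi else max (rows_max rows lo hi) (table_max T lo hi))"

text \<open>The ceiling of \<open>10^8 / a\<close> in integer arithmetic.\<close>

definition inv_scaled :: "nat \<Rightarrow> nat" where
  "inv_scaled a = (100000000 + (a - 1)) div a"

text \<open>The reciprocal is taken at \<open>lo\<close>, where it is largest on the
  interval.\<close>

definition split_bound :: "(nat \<times> (nat \<times> nat) list) list \<Rightarrow> nat \<Rightarrow> nat \<Rightarrow> nat" where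
  "split_bound T lo hi = table_max T lo hi + inv_scaled lo"

text \<open>
  A step \<open>(U, a, p)\<close> bounds \<open>C\<close> on the next interval \<open>{L..U}\<close>, every element of which is a sum of an
  element of \<open>{a..a + p}\<close> and one of \<open>{L - a..U - (a + p)}\<close>, both intervals lying below \<open>L\<close>.
\<close>

fun extend_table where
  "extend_table [] L T = (L, T)"
| "extend_table ([] # css) L T = extend_table css L ((L, []) # T)"
| "extend_table (((U, a, p) # cs) # css) L [] = (L, [])"
| "extend_table (((U, a, p) # cs) # css) L ((B, rows) # T) =
     (if 0 < a \<and> L + p \<le> U \<and> a + p < L \<and> U < L + a + p
      then extend_table (cs # css) (Suc U)
        ((B, (L, max (split_bound ((B, rows) # T) a (a + p))
                     (split_bound ((B, rows) # T) (L - a) (U - (a + p)))) # rows) # T)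
      else (L, (B, rows) # T))"

text \<open>Found by a computer search for interval splittings that keep the bound below \<open>2.0005\<close>.\<close>

definition schedule :: "(nat \<times> nat \<times> nat) list list" where
  "schedule = [
    [(2,1,0), (3,1,0), (4,2,0), (5,1,0), (6,2,0), (7,3,0), (8,4,0), (9,1,0), (10,2,0), (11,3,0),
     (12,4,0), (15,2,1), (16,8,0), (17,1,0), (18,2,0), (20,3,1), (21,5,0), (22,6,0), (23,1,0),
     (24,8,0), (27,4,1), (28,12,0), (31,8,1), (32,16,0), (33,1,0), (34,2,0), (36,3,1), (38,5,1),
     (39,1,0), (40,8,0)],
    [(41,1,0), (42,10,0), (44,11,1), (47,2,1), (48,16,0), (55,16,1), (56,24,0), (62,24,0), (63,7,0),
     (64,32,0), (65,1,0), (66,2,0), (68,3,1), (70,5,1), (72,7,1), (74,9,1), (76,11,1), (79,2,1),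
     (80,16,0), (83,6,1), (84,20,0), (85,1,0), (86,22,0), (87,1,0), (88,24,0), (95,16,3), (96,32,0),
     (110,32,6), (111,35,0), (112,48,0)],
    [(120,42,2), (127,56,0), (128,64,0), (129,1,0), (130,2,0), (132,3,1), (134,5,1), (136,7,1),
     (140,9,3), (146,4,2), (148,19,1), (149,2,0), (150,22,0), (151,3,0), (152,24,0), (159,16,3),
     (160,32,0), (167,28,0), (168,40,0), (170,1,1), (172,43,1), (175,2,1), (176,48,0), (188,48,0),
     (191,17,2), (192,64,0), (212,64,8), (215,84,0), (216,88,0), (223,84,0)],
    [(224,96,0), (236,96,0), (244,65,7), (252,112,0), (254,37,1), (255,84,0), (256,128,0),
     (257,1,0), (258,2,0), (260,3,1), (262,5,1), (264,7,1), (268,9,3), (273,4,1), (274,18,0),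
     (276,19,1), (277,2,0), (278,22,0), (279,3,0), (280,24,0), (283,6,1), (284,28,0), (291,24,0),
     (292,36,0), (294,37,1), (295,1,0), (296,40,0), (298,1,1), (299,43,0), (300,44,0)],
    [(303,2,1), (304,48,0), (311,48,0), (312,56,0), (316,48,0), (324,56,0), (340,64,8), (341,37,0),
     (342,86,0), (343,1,0), (344,88,0), (351,65,6), (352,96,0), (364,96,0), (372,65,7), (380,112,0),
     (382,37,1), (383,84,0), (384,128,0), (408,128,12), (420,129,11), (426,128,5), (427,171,0),
     (428,172,0), (431,135,2), (432,176,0), (434,139,1), (444,131,9), (447,171,0), (448,192,0)],
    [(460,192,0), (462,168,0), (466,35,3), (468,19,1), (470,21,1), (482,129,11), (492,131,9),
     (500,65,7), (504,73,3), (508,73,3), (510,216,0), (511,84,0), (512,256,0), (513,1,0), (514,2,0),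
     (516,3,1), (518,5,1), (520,7,1), (524,9,3), (527,2,1), (528,16,0), (532,17,3), (534,21,1),
     (535,1,0), (536,24,0), (539,24,0), (540,28,0), (546,24,0), (550,35,3), (554,32,3)],
    [(556,43,1), (562,33,5), (567,32,1), (568,56,0), (580,56,0), (582,64,0), (584,71,1), (586,64,0),
     (588,75,1), (591,2,1), (592,80,0), (597,64,0), (598,86,0), (599,1,0), (600,88,0), (612,88,0),
     (620,96,0), (623,33,2), (624,112,0), (636,112,0), (639,69,2), (640,128,0), (663,128,12),
     (664,152,0), (676,129,11), (682,147,1), (684,171,1), (687,171,1), (688,176,0), (695,171,1)],
    [(696,344,0), (703,129,6), (704,192,0), (716,192,0), (728,129,11), (740,129,11), (748,224,0),
     (756,65,7), (764,133,7), (767,69,2), (768,256,0), (792,256,12), (804,257,11), (818,293,1),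
     (828,304,0), (836,133,7), (844,133,7), (853,257,8), (854,342,0), (855,267,0), (856,344,0),
     (863,257,6), (864,352,0), (876,352,0), (878,344,0), (882,292,2), (892,259,9), (894,293,1),
     (896,312,0), (906,129,9)],
    [(908,139,1), (912,2,2), (918,384,0), (920,11,1), (932,257,11), (936,69,3), (939,73,2),
     (940,172,0), (952,257,11), (964,257,11), (972,261,7), (980,65,7), (984,73,3), (996,129,11),
     (1003,133,6), (1004,300,0), (1007,65,2), (1008,304,0), (1012,69,3), (1016,73,3), (1020,9,3),
     (1023,17,2), (1024,512,0), (1025,1,0), (1026,2,0), (1028,3,1), (1030,5,1), (1032,7,1),
     (1036,9,3), (1048,8,4)],
    [(1055,16,3), (1056,32,0), (1057,33,0), (1062,34,4), (1066,2,2), (1068,43,1), (1079,42,1),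
     (1080,56,0), (1092,56,0), (1093,69,0), (1096,70,2), (1098,35,1), (1099,75,0), (1100,76,0),
     (1109,70,5), (1110,86,0), (1111,75,0), (1112,88,0), (1119,84,0), (1120,96,0), (1134,64,8),
     (1144,131,9), (1152,65,7), (1170,128,12), (1171,147,0), (1172,148,0), (1173,137,0),
     (1174,150,0), (1175,139,0), (1176,152,0)],
    [(1183,152,0), (1184,160,0), (1188,152,0), (1194,128,4), (1196,171,1), (1199,2,1), (1200,176,0),
     (1212,176,0), (1220,133,7), (1228,192,0), (1240,129,11), (1252,129,11), (1260,133,7),
     (1272,257,11), (1278,216,0), (1280,84,0), (1304,256,12), (1316,280,0), (1330,256,12),
     (1340,131,9), (1348,261,7), (1356,292,2), (1365,257,8), (1366,342,0), (1367,1,0), (1368,344,0),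
     (1372,257,3), (1374,5,1), (1375,7,0), (1376,352,0)],
    [(1380,9,3), (1382,5,1), (1386,17,3), (1388,11,1), (1390,21,1), (1394,2,2), (1398,6,2),
     (1406,32,6), (1407,17,0), (1408,384,0), (1420,384,0), (1432,513,11), (1440,65,7), (1452,8,4),
     (1464,257,11), (1471,32,0), (1472,704,0), (1484,448,0), (1490,427,1), (1496,56,0), (1512,64,8),
     (1520,80,0), (1532,513,11), (1535,529,2), (1536,512,0), (1538,533,1), (1560,512,12),
     (1580,128,12), (1592,513,11), (1604,513,11)],
    [(1612,133,7), (1624,513,11), (1636,257,11), (1644,261,7), (1658,256,12), (1664,224,0),
     (1676,257,11), (1694,304,0), (1706,256,10), (1708,683,1), (1720,513,11), (1724,547,3),
     (1726,549,1), (1728,555,1), (1730,555,1), (1732,536,0), (1734,549,1), (1736,540,0),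
     (1742,352,0), (1746,35,3), (1752,312,0), (1758,696,0), (1774,384,0), (1782,342,0), (1784,75,1),
     (1791,352,0), (1792,768,0), (1804,768,0), (1822,432,0), (1838,448,0)],
    [(1848,131,9), (1876,128,12), (1888,152,0), (1914,512,12), (1930,540,0), (1946,555,1),
     (1964,512,12), (1982,592,0), (2004,256,12), (2020,284,0), (2036,299,1), (2047,312,0),
     (2048,1024,0), (2064,1024,4), (2068,17,3), (2070,21,1), (2078,6,2), (2079,9,0), (2080,32,0),
     (2086,33,5), (2098,1025,11), (2103,16,1), (2104,56,0), (2111,1025,6), (2112,64,0), (2114,1,1),
     (2120,67,5), (2127,6,1), (2128,80,0), (2131,9,2)],
    [(2132,84,0), (2142,64,8), (2143,11,0), (2144,96,0), (2158,64,8), (2159,40,0), (2160,112,0),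
     (2166,33,5), (2172,86,0), (2176,56,0), (2188,129,11), (2196,72,4), (2210,128,12),
     (2226,128,12), (2236,1027,9), (2244,133,7), (2260,128,12), (2272,129,11), (2284,129,11),
     (2288,168,0), (2300,129,11), (2340,112,0), (2341,293,0), (2342,294,0), (2343,112,0),
     (2344,296,0), (2346,112,0), (2347,299,0), (2348,300,0), (2389,112,0)],
    [(2390,342,0), (2391,112,0), (2392,344,0), (2399,112,0), (2400,352,0), (2412,112,0),
     (2431,352,0), (2432,384,0), (2652,352,0), (2730,600,0), (2731,683,0), (2732,684,0),
     (2735,600,0), (2736,688,0), (2900,600,0), (2994,768,0), (3000,263,5), (3004,265,3),
     (3008,274,2), (3010,278,0), (3012,275,1), (3068,768,0), (3308,1008,0), (3483,1200,0),
     (3486,1094,2), (3488,1095,1), (3490,1099,1), (3492,1099,1), (3496,1093,3), (3500,1200,0)],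
    [(3512,1433,7), (3514,1171,1), (3516,1171,1), (3518,1176,0), (3520,1171,1), (3522,1174,0),
     (3524,1176,0), (3526,1184,0), (3528,1095,1), (3583,1433,7), (3584,1536,0), (3739,1433,7),
     (3764,256,12), (3776,280,0), (3790,292,2), (3800,304,0), (3808,312,0), (3824,296,0),
     (3840,312,0), (3842,1110,0), (3844,1112,0), (3852,261,7), (3866,854,0), (3880,352,0),
     (3892,40,0), (3900,48,0), (3912,384,0), (3928,71,5), (3940,88,0), (3948,96,0)],
    [(3960,432,0), (3976,448,0), (3992,128,12), (4004,152,0), (4020,512,12), (4048,1024,12),
     (4064,536,0), (4080,1067,1), (4094,568,0), (4095,1,0), (4096,2048,0), (4223,128,1),
     (4224,128,0), (4228,129,3), (4230,133,1), (4236,135,5), (4242,4,2), (4244,147,1), (4247,2,1),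
     (4248,152,0), (4263,16,0), (4264,168,0), (4267,2,1), (4268,172,0), (4287,24,0), (4288,192,0),
     (4351,256,1), (4352,256,0), (4369,112,0), (4370,274,0)],
    [(4372,275,1), (4375,2,1), (4376,280,0), (4379,2,1), (4380,284,0), (4391,8,3), (4392,296,0),
     (4394,1,1), (4395,299,0), (4396,300,0), (4399,2,1), (4400,304,0), (4682,587,1), (4684,587,1),
     (4687,2,1), (4688,592,0), (4693,4,1), (4694,598,0), (5034,940,0), (5294,1200,0), (5461,1366,1),
     (5462,1366,0), (5463,1,0), (5464,1368,0), (5471,1093,0), (5472,1376,0), (5503,1433,0),
     (5504,1408,0), (5522,1433,0), (5524,19,1)],
    [(5526,21,1), (5534,65,7), (5536,71,1), (5544,65,7), (5548,73,3), (5720,1707,0), (5721,259,0),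
     (5732,258,10), (5740,261,7), (5746,1058,4), (5750,1059,3), (5752,1067,1), (5756,1059,3),
     (5758,293,1), (5786,28,0), (5822,64,0), (5854,96,0), (5886,128,0), (5918,160,0), (5950,192,0),
     (5982,224,0), (6026,258,10), (6052,293,1), (6082,528,6), (6110,352,0), (6142,384,0),
     (6146,598,0), (6172,624,0), (6206,448,0), (6232,683,1)],
    [(6282,512,12), (6292,528,6), (6305,568,0), (6310,2082,4), (6322,2080,6), (6330,2080,6),
     (6334,2083,3), (6340,2104,0), (6348,2112,0), (6356,2115,5), (6364,2128,0), (6368,2117,3),
     (6374,2081,5), (6380,2144,0), (6384,2117,3), (6388,2117,3), (6396,2160,0), (6440,72,4),
     (6446,2065,5), (6450,2067,3), (6458,2080,6), (6462,2083,3), (6466,2083,3), (6472,2115,5),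
     (6478,2081,5), (6482,2083,3), (6484,2112,0), (6492,2115,5), (6496,2117,3), (6500,2117,3)],
    [(6508,1029,7), (6512,2117,3), (6516,2117,3), (6520,2117,3), (6524,1059,3), (6526,1061,1),
     (6528,2132,0), (6530,1067,1), (6534,1059,3), (6540,1031,5), (6556,160,0), (6620,224,0),
     (6690,293,1), (6748,352,0), (6782,1024,0), (6844,448,0), (6930,528,6), (6994,598,0),
     (7080,683,1), (7180,640,0), (7224,683,1), (7308,768,0), (7404,864,0), (7464,1067,1),
     (7564,1024,0), (7608,1067,1), (7634,2080,6), (7660,2112,0), (7680,2132,0), (7764,1368,0)],
    [(7804,1408,0), (7844,2080,6), (7916,1376,0), (7948,1408,0), (8012,1472,0), (8104,1707,1),
     (8188,1792,0), (8191,1707,1), (8192,4096,0), (8193,1,0), (8194,2,0), (8196,3,1), (8198,5,1),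
     (8200,7,1), (8204,9,3), (8216,8,4), (8226,20,2), (8232,28,0), (8242,32,6), (8248,43,1),
     (8252,48,0), (8256,56,0), (8258,65,1), (8264,67,5), (8268,73,3), (8276,65,7), (8284,80,0),
     (8292,88,0), (8300,96,0), (8312,42,2)],
    [(8316,48,0), (8324,56,0), (8332,133,7), (8343,129,10), (8344,152,0), (8354,86,0), (8364,96,0),
     (8372,168,0), (8380,112,0), (8388,56,0), (8408,128,12), (8416,84,0), (8420,88,0), (8428,96,0),
     (8436,168,0), (8444,112,0), (8584,128,12), (8727,384,0), (8728,536,0), (8759,384,0),
     (8760,568,0), (8791,384,0), (8792,600,0), (8828,384,0), (8895,624,0), (8896,704,0),
     (9068,624,0), (9216,864,0), (9240,1024,12), (9252,513,11)],
    [(9266,1058,4), (9272,1067,1), (9284,513,11), (9291,1024,6), (9292,1100,0), (9303,1025,10),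
     (9304,1112,0), (9311,513,6), (9312,1120,0), (9316,521,3), (9330,1058,4), (9336,1067,1),
     (9348,1080,0), (9368,1024,12), (9380,1025,11), (9391,1056,6), (9392,1200,0), (9394,1061,1),
     (9400,1067,1), (9406,1057,5), (9412,1080,0), (9420,517,7), (9432,129,11), (9444,129,11),
     (9452,133,7), (9464,1195,1), (9468,73,3), (9512,1067,1), (9764,296,0), (10004,536,0)],
    [(10236,768,0), (10332,864,0), (10580,1112,0), (10668,1200,0), (10876,1408,0), (10940,1472,0),
     (11176,1707,1), (11260,1792,0), (11306,5523,25), (11500,2048,0)]
  ]"

text \<open>
  Conditional equations instead of the defining ones with \<open>if\<close>: the congruence rule for \<open>if\<close> would
  make the simplifier traverse the whole table again after every comparison.
\<close>

lemma rows_max_rules: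
  "hi < L \<Longrightarrow> rows_max ((L, c) # rows) lo hi = rows_max rows lo hi"
  "L \<le> hi \<Longrightarrow> L \<le> lo \<Longrightarrow> rows_max ((L, c) # rows) lo hi = c"
  "lo < L \<Longrightarrow> L \<le> hi \<Longrightarrow> rows_max ((L, c) # rows) lo hi = max c (rows_max rows lo hi)"
  by auto

lemma table_max_rules:
  "hi < B \<Longrightarrow> table_max ((B, rows) # T) lo hi = table_max T lo hi"
  "B \<le> hi \<Longrightarrow> B \<le> lo \<Longrightarrow> table_max ((B, rows) # T) lo hi = rows_max rows lo hi"
  "lo < B \<Longrightarrow> B \<le> hi \<Longrightarrow>
     table_max ((B, rows) # T) lo hi = max (rows_max rows lo hi) (table_max T lo hi)"
  by auto

lemma extend_table_rule:
  assumes "0 < a" "L + p \<le> U" "a + p < L" "U < L + a + p"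
  shows "extend_table (((U, a, p) # cs) # css) L ((B, rows) # T) = extend_table (cs # css) (Suc U)
        ((B, (L, max (split_bound ((B, rows) # T) a (a + p))
                     (split_bound ((B, rows) # T) (L - a) (U - (a + p)))) # rows) # T)"
  using assms by simp

text \<open>In units of \<open>10^-8\<close>, the first bound is 2.0005 and the second is exactly
  \<open>2.0005 - 2.001 / 5750\<close>. The range from 5750 to 11500 is where repeated halving of
  larger numbers ends, and it needs this extra slack.\<close>

definition table_ok :: "nat \<times> (nat \<times> (nat \<times> nat) list) list \<Rightarrow> bool" where
  "table_ok = (\<lambda>(L, T). 11501 \<le> L \<and>
     table_max T 1 11500 \<le> 200050000 \<and> table_max T 5750 11500 \<le> 200015200)"

lemma table_ok: "table_ok (extend_table schedule 2 [(1, [(1, 0)])])"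
  unfolding schedule_def
  by (simp add: rows_max_rules table_max_rules extend_table_rule split_bound_def inv_scaled_def
      table_ok_def del: rows_max.simps(2) table_max.simps(2) extend_table.simps(4))

section \<open>Soundness of the computed table\<close>

lemma rows_max_Cons:
  "lo < L \<Longrightarrow> rows_max rows lo hi \<le> rows_max ((L, c) # rows) lo hi"
  "L \<le> hi \<Longrightarrow> c \<le> rows_max ((L, c) # rows) lo hi"
  by auto

text \<open>The first part keeps lookups valid for numbers below the new row, since they can only
  grow; the second makes every lookup reaching the new row at least its bound.\<close>

lemma table_max_Cons_row:
  "lo < L \<Longrightarrow> table_max ((B, rows) # T) lo hi \<le> table_max ((B, (L, c) # rows) # T) lo hi"
  "B \<le> L \<Longrightarrow> L \<le> hi \<Longrightarrow> c \<le> table_max ((B, (L, c) # rows) # T) lo hi"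
  using rows_max_Cons(1)[of lo L rows hi c] rows_max_Cons(2)[of L hi c rows lo]
  by (auto simp del: rows_max.simps)

lemma inv_scaled_ge: "0 < a \<Longrightarrow> 1 / real a \<le> real (inv_scaled a) / 100000000"
proof -
  assume a: "0 < a"
  \<comment> \<open>The remainder takes away at most the \<open>a - 1\<close> added before
    dividing.\<close>
  have "100000000 + (a - 1) = a * inv_scaled a + (100000000 + (a - 1)) mod a"
    unfolding inv_scaled_def by simp
  moreover have "(100000000 + (a - 1)) mod a \<le> a - 1"
    using mod_less_divisor[OF a, of "100000000 + (a - 1)"] by linarith
  ultimately have "100000000 \<le> a * inv_scaled a" by linarith
  then have "real 100000000 \<le> real a * real (inv_scaled a)"
    by (simp only: of_nat_mult[symmetric] of_nat_le_iff)
  then show ?thesis using a by (simp add: field_simps)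
qed

text \<open>Everything below \<open>L\<close> is covered. Block starts do not exceed
  \<open>L\<close>, so that a row added to the front block is seen by every lookup reaching
  it.\<close>

definition table_sound :: "nat \<Rightarrow> (nat \<times> (nat \<times> nat) list) list \<Rightarrow> bool" where
  "table_sound L T \<longleftrightarrow>
     (\<forall>lo r hi. 1 \<le> r \<longrightarrow> r < L \<longrightarrow> lo \<le> r \<longrightarrow> r \<le> hi \<longrightarrow> balanced r (real (table_max T lo hi) / 100000000)) \<and>
     (\<forall>b \<in> fst ` set T. b \<le> L)"

lemma balanced_table:
  "table_sound L T \<Longrightarrow> 1 \<le> r \<Longrightarrow> r < L \<Longrightarrow> lo \<le> r \<Longrightarrow> r \<le> hi \<Longrightarrow> table_max T lo hi \<le> c
     \<Longrightarrow> balanced r (real c / 100000000)"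
  unfolding table_sound_def by (meson balanced_mono divide_right_mono of_nat_mono zero_le_numeral)

lemma split_bound_ge:
  assumes "table_sound L T" "0 < lo" "lo \<le> r" "r \<le> hi" "r < L"
  shows "\<exists>C. balanced r C \<and> C + 1 / real r \<le> real (split_bound T lo hi) / 100000000"
proof (intro exI conjI)
  show "balanced r (real (table_max T lo hi) / 100000000)"
    using assms by (intro balanced_table[OF assms(1)]) auto
  have "1 / real r \<le> 1 / real lo" using assms by (simp add: frac_le)
  then show "real (table_max T lo hi) / 100000000 + 1 / real r \<le> real (split_bound T lo hi) / 100000000"
    using inv_scaled_ge[OF assms(2)] by (simp add: split_bound_def add_divide_distrib)
qed

text \<open>This is the step taken when a group of the schedule is used up: a new block opens at the
  first uncovered number.\<close>

lemma table_sound_block: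
  assumes "table_sound L T"
  shows "table_sound L ((L, []) # T)"
  using assms unfolding table_sound_def by auto

lemma table_sound_row:
  fixes B rows T
  defines "S \<equiv> (B, rows) # T"
  assumes T: "table_sound L S"
    and ok: "0 < a" "L + p \<le> U" "a + p < L" "U < L + a + p"
    and c: "c = max (split_bound S a (a + p)) (split_bound S (L - a) (U - (a + p)))"
  shows "table_sound (Suc U) ((B, (L, c) # rows) # T)" (is "table_sound _ ?T'")
  unfolding table_sound_def
proof (intro conjI allI impI)
  fix lo r hi assume r: "1 \<le> r" "r < Suc U" "lo \<le> r" "r \<le> hi"
  show "balanced r (real (table_max ?T' lo hi) / 100000000)"
  proof (cases "r < L")
    case True
    then show ?thesis
      using r table_max_Cons_row(1)[of lo L B rows T hi c]
      by (intro balanced_table[OF T]) (auto simp: S_def simp del: table_max.simps)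
  next
    case False
    \<comment> \<open>As \<open>r\<close> grows from \<open>L\<close> to \<open>U\<close>, the first
      summand \<open>a + s\<close> grows until it reaches \<open>a + p\<close>; from then on only
      the second summand grows. Each thus stays in its interval.\<close>
    define s where "s = min p (r - L)"
    have s: "s \<le> p" "a + s < L" "L - a \<le> r - (a + s)" "r - (a + s) \<le> U - (a + p)" "a + s \<le> r"
      using False ok r by (auto simp: s_def min_def)
    obtain C where C: "balanced (a + s) C" "C + 1 / real (a + s) \<le> real c / 100000000"
      using split_bound_ge[OF T, of a "a + s" "a + p"] ok s unfolding c
      by (force intro: order_trans divide_right_mono)
    obtain D where D: "balanced (r - (a + s)) D" "D + 1 / real (r - (a + s)) \<le> real c / 100000000"
      using split_bound_ge[OF T, of "L - a" "r - (a + s)" "U - (a + p)"] ok s unfolding c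
      by (force intro: order_trans divide_right_mono)
    have "balanced (a + s + (r - (a + s))) (real c / 100000000)"
      using ok s by (intro balanced_add[OF C(1) D(1) _ _ C(2) D(2)]) auto
    then have "balanced r (real c / 100000000)" using s by simp
    moreover have "c \<le> table_max ?T' lo hi"
      using T False r by (intro table_max_Cons_row(2)) (auto simp: table_sound_def S_def)
    ultimately show ?thesis by (auto intro: balanced_mono divide_right_mono)
  qed
next
  show "\<forall>b\<in>fst ` set ?T'. b \<le> Suc U" using T ok by (auto simp: table_sound_def S_def)
qed

text \<open>A step violating its side conditions ends the run with the table built so far, so
  soundness holds for every schedule; how far a particular schedule gets is left to
  evaluation.\<close>

lemma extend_table_sound:
  "table_sound L T \<Longrightarrow> extend_table css L T = (L', T') \<Longrightarrow> table_sound L' T'"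
proof (induction css L T rule: extend_table.induct)
  case (4 U a p cs css L B rows T)
  show ?case
  proof (cases "0 < a \<and> L + p \<le> U \<and> a + p < L \<and> U < L + a + p")
    case True
    then show ?thesis
      using 4 table_sound_row[OF "4.prems"(1), of a p U] by (auto simp del: table_max.simps)
  next
    case False
    then show ?thesis
      using "4.prems" unfolding extend_table.simps(4) if_not_P[OF False] by simp
  qed
qed (auto intro: table_sound_block simp: table_sound_def)

section \<open>From the table to all numbers of classes\<close>

lemma balanced_finite:
  assumes "1 \<le> r" "r \<le> 11500"
  shows "balanced r 2.0005" and "5750 \<le> r \<Longrightarrow> balanced r (2.0005 - 2.001 / 5750)"
proof -
  \<comment> \<open>The initial table records only the bound 0 for a single class.\<close>
  have "table_sound 2 [(1, [(1, 0)])]"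
    unfolding table_sound_def
  proof (intro conjI allI impI)
    fix lo r hi :: nat assume "1 \<le> r" "r < 2" "lo \<le> r" "r \<le> hi"
    then have "r = 1" "lo \<le> 1" "1 \<le> hi" by linarith+
    then show "balanced r (real (table_max [(1, [(1, 0)])] lo hi) / 100000000)"
      using balanced_1 by auto
  qed simp
  moreover obtain L T where LT: "extend_table schedule 2 [(1, [(1, 0)])] = (L, T)"
    by (metis surj_pair)
  ultimately have T: "table_sound L T" by (rule extend_table_sound)
  have L: "11501 \<le> L" "table_max T 1 11500 \<le> 200050000" "table_max T 5750 11500 \<le> 200015200"
    using table_ok unfolding LT table_ok_def by simp_all
  show "balanced r 2.0005"
    using balanced_table[OF T, of r 1 11500 200050000] assms L by simp
  show "balanced r (2.0005 - 2.001 / 5750)" if "5750 \<le> r"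
    using balanced_table[OF T, of r 5750 11500 200015200] assms L that by simp
qed

text \<open>Splitting \<open>r\<close> into halves preserves a bound of the form \<open>C - x / r\<close> once \<open>x > 2\<close>: the part
  \<open>b \<le> (r + 1) / 2\<close> contributes \<open>C - (x - 1) / b\<close>, and \<open>x / r \<le> (x - 1) / b\<close> for large \<open>b\<close>.\<close>

lemma balanced_large: "5750 \<le> r \<Longrightarrow> balanced r (2.0005 - 2.001 / real r)"
proof (induction r rule: less_induct)
  case (less r)
  show ?case
  proof (cases "r \<le> 11500")
    case True
    have "2.001 / real r \<le> 2.001 / 5750" using less.prems by (intro divide_left_mono) auto
    then show ?thesis
      using balanced_finite(2)[of r] less.prems True by (auto intro: balanced_mono)
  next
    case False
    define a b where "a = r div 2" and "b = r - a"
    \<comment> \<open>Since \<open>r\<close> exceeds 11500, both halves are at least 5750 and the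
      induction hypothesis applies to them.\<close>
    have ab: "5750 \<le> a" "5750 \<le> b" "a < r" "b < r" "r = a + b" "2 * a \<le> 2 * r" "2 * b \<le> r + 1" "2 * a \<le> r"
      using False by (auto simp: a_def b_def)
    have bound: "2.0005 - 2.001 / real x + 1 / real x \<le> 2.0005 - 2.001 / real r"
      if x: "5750 \<le> x" "2 * x \<le> r + 1" for x
    proof -
      \<comment> \<open>This amounts to \<open>x \<ge> 1001\<close>; the term \<open>-1\<close> pays
        for the rounding when \<open>r\<close> is odd.\<close>
      have "2.001 * real x \<le> 1.001 * (2 * real x - 1)" using x by simp
      also have "\<dots> \<le> 1.001 * real r" using x by simp
      finally have "2.001 * real x \<le> 1.001 * real r" .
      then have "2.001 / real r \<le> 1.001 / real x" using x by (simp add: field_simps)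
      then show ?thesis by (simp add: diff_divide_distrib[symmetric])
    qed
    show ?thesis
      unfolding \<open>r = a + b\<close>
    proof (rule balanced_add[OF less.IH less.IH])
      show "2.0005 - 2.001 / real a + 1 / real a \<le> 2.0005 - 2.001 / real (a + b)"
        using bound[of a] ab by simp
      show "2.0005 - 2.001 / real b + 1 / real b \<le> 2.0005 - 2.001 / real (a + b)"
        using bound[of b] ab by simp
    qed (use ab in auto)
  qed
qed

lemma balanced_all:
  assumes "1 \<le> r"
  shows "balanced r 2.0005"
proof (cases "r \<le> 11500")
  case True
  then show ?thesis by (rule balanced_finite(1)[OF assms])
next
  case False
  then show ?thesis by (intro balanced_mono[OF balanced_large]) auto
qed

section \<open>Transfer to finite and infinite sequences of vectors\<close>

theorem theorem3:
  shows "\<exists>C :: nat \<Rightarrow> real. (\<forall>r\<ge>2. C r \<le> 2.0005) \<and>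
    (\<forall>(d::nat) (r::nat) (N :: (nat \<Rightarrow> real) \<Rightarrow> real) (V :: nat \<Rightarrow> nat \<Rightarrow> real) (I :: nat set).
       d \<ge> 1 \<longrightarrow> r \<ge> 2 \<longrightarrow> norm_on d N \<longrightarrow> seq_index I \<longrightarrow>
       (\<forall>i\<in>I. V i \<in> Rvec d \<and> N (V i) \<le> 1) \<longrightarrow>
       (\<exists>f :: nat \<Rightarrow> nat. (\<forall>i\<in>I. f i \<in> {1..r}) \<and>
          (\<forall>k\<in>I. \<forall>j\<in>{1..r}.
             N (\<lambda>c. (\<Sum>i\<in>{i\<in>{1..k}. f i = j}. V i c) - (1 / real r) * (\<Sum>i\<in>{1..k}. V i c))
               \<le> C r * real d)))"
proof (intro exI[of _ "\<lambda>_. 2.0005"] conjI allI impI)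
  fix d r :: nat and N and V :: "nat \<Rightarrow> nat \<Rightarrow> real" and I
  assume r: "r \<ge> 2" and N: "norm_on d N" and I: "seq_index I"
    and V: "\<forall>i\<in>I. V i \<in> Rvec d \<and> N (V i) \<le> 1"
  \<comment> \<open>Padding with zero vectors, at index 0 and beyond the end of a finite sequence,
    gives a total sequence in the unit ball.\<close>
  define W where "W i = (if i \<in> I then V i else (\<lambda>_. 0))" for i
  have "\<forall>i. W i \<in> Rvec d \<and> N (W i) \<le> 1"
    using V norm_on_zero[OF N] by (auto simp: W_def Rvec_def)
  moreover have "balanced r 2.0005" using r by (intro balanced_all) simp
  ultimately obtain f where f: "\<forall>i. f i \<in> {1..r}" "\<forall>k. \<forall>j\<in>{1..r}.
      N (\<lambda>c. \<Sum>i\<in>{1..k}. (of_bool (f i = j) - 1 / real r) * W i c) \<le> 2.0005 * real d"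
    using balancedD[OF _ N, of r "2.0005" W] by blast
  have "N (\<lambda>c. (\<Sum>i\<in>{i\<in>{1..k}. f i = j}. V i c) - (1 / real r) * (\<Sum>i\<in>{1..k}. V i c)) \<le> 2.0005 * real d"
    if k: "k \<in> I" and j: "j \<in> {1..r}" for k j
  proof -
    \<comment> \<open>Every prefix in question lies within \<open>I\<close>, so padding does not
      change its sums.\<close>
    have "{1..k} \<subseteq> I" using I k by (auto simp: seq_index_def)
    have "(\<Sum>i\<in>{i\<in>{1..k}. f i = j}. V i c) - (1 / real r) * (\<Sum>i\<in>{1..k}. V i c)
        = (\<Sum>i\<in>{1..k}. (of_bool (f i = j) - 1 / real r) * W i c)" for c
    proof -
      have "(\<Sum>i\<in>{i\<in>{1..k}. f i = j}. V i c) = (\<Sum>i\<in>{1..k}. of_bool (f i = j) * V i c)"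
        by (rule sum.mono_neutral_cong_left) auto
      then have "(\<Sum>i\<in>{i\<in>{1..k}. f i = j}. V i c) - (1 / real r) * (\<Sum>i\<in>{1..k}. V i c)
          = (\<Sum>i\<in>{1..k}. (of_bool (f i = j) - 1 / real r) * V i c)"
        by (simp only: sum_distrib_left sum_subtractf left_diff_distrib)
      also have "\<dots> = (\<Sum>i\<in>{1..k}. (of_bool (f i = j) - 1 / real r) * W i c)"
        using \<open>{1..k} \<subseteq> I\<close> by (intro sum.cong) (auto simp: W_def)
      finally show ?thesis .
    qed
    then show ?thesis using f(2) j by simp
  qed
  then show "\<exists>f. (\<forall>i\<in>I. f i \<in> {1..r}) \<and> (\<forall>k\<in>I. \<forall>j\<in>{1..r}.
      N (\<lambda>c. (\<Sum>i\<in>{i\<in>{1..k}. f i = j}. V i c) - (1 / real r) * (\<Sum>i\<in>{1..k}. V i c)) \<le> 2.0005 * real d)"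
    using f(1) by blast
qed simp

end
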